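(* Let $\xi=[0,a_1,a_2,a_3,\dots]$ denote the continued fraction expansion of an irrational real number $\xi$ with $0<\xi<1$. Then $\xi$ belongs to the set $\{\xi_{\mathbf m}\,;\,\mathbf m\in\Sigma^*\}$ if and only if there exists a finite product $\psi$ of $U$ and $V$ such that $(\mathbf a\mathbf b)^{(VU)^i\psi}$ is a prefix of $P:=a_1a_2a_3\cdots$ for each $i\ge0$.
   Context: Words: $\mathcal W$ is the monoid of finite words on the set of positive integers under concatenation; $\mathbf a=1\,1$ and $\mathbf b=2\,2$; $\mathcal W_0$ is the sub-monoid of $\mathcal W$ generated by $\mathbf a$ and $\mathbf b$. Endomorphisms of $\mathcal W_0$ act on the right, $\mathbf w\mapsto\mathbf w^\varphi$, so that $\mathbf w^{\varphi\psi}=(\mathbf w^{\varphi})^{\psi}$. $U$ and $V$ are the endomorphisms of $\mathcal W_0$ determined by $\mathbf a^U=\mathbf a\mathbf b$, $\mathbf b^U=\mathbf b$, $\mathbf a^V=\mathbf a$, $\mathbf b^V=\mathbf a\mathbf b$. A finite product of $U$ and $V$ may be empty (the identity). Markoff tree: $\Sigma^*$ is the set of nodes of the following tree of ordered triples of positive integers, all of which are solutions of $m^2+m_1^2+m_2^2=3mm_1m_2$. The root is $(2,1,1)$; it has a single successor, $(5,1,2)$, which is a left successor. Every other node $(m,m_1,m_2)$ has a left successor $(3mm_1-m_2,m_1,m)$ and a right successor $(3mm_2-m_1,m,m_2)$. A \emph{zigzag} is an infinite sequence of nodes $\mathbf m^{(1)},\mathbf m^{(2)},\dots$ such that, for each $i\ge1$,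 $\mathbf m^{(i+1)}$ is a successor of $\mathbf m^{(i)}$ on some side (left or right) and $\mathbf m^{(i+2)}$ is a successor of $\mathbf m^{(i+1)}$ on the other side. It is \emph{maximal} if it cannot be extended to a zigzag by inserting the ancestor of $\mathbf m^{(1)}$ (the node of which it is a successor) as first element. Each $\mathbf m\in\Sigma^*$ is the first element of a unique maximal zigzag. Matrices: put $M=\begin{pmatrix}3&1\\-1&0\end{pmatrix}$ and consider the binary tree of triples of matrices with root $\left(\begin{pmatrix}5&3\\3&2\end{pmatrix},\begin{pmatrix}1&1\\1&2\end{pmatrix},\begin{pmatrix}2&1\\1&1\end{pmatrix}\right)$, where each node $(\mathbf x,\mathbf x_1,\mathbf x_2)$ has left successor $(\mathbf x_1M\mathbf x,\mathbf x_1,\mathbf x)$ and right successor $(\mathbf xM\mathbf x_2,\mathbf x,\mathbf x_2)$. For $\mathbf m\in\Sigma^*$, $\mathbf m\ne(2,1,1)$, let $\mathbf x_{\mathbf m}$ be the first component of the node of this matrix tree occupying the same position as $\mathbf m$ in the subtree of the Markoff tree rooted at $(5,1,2)$; put $\mathbf x_{(2,1,1)}=\begin{pmatrix}2&1\\1&1\end{pmatrix}$. For $\mathbf m=(m,m_1,m_2)$, the matrix $\mathbf x_{\mathbf m}=\begin{pmatrix}m&k\\k&\ell\end{pmatrix}$ is symmetric in $\mathrm{SL}_2(\mathbb Z)$ with upper left entry $m$, and one sets $\alpha_{\mathbf m}=\frac{2k-3m+\sqrt{9m^2-4}}{2m}$. For $\mathbf m\in\Sigma^*$, with maximal zigzag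 $\mathbf m=\mathbf m^{(1)},\mathbf m^{(2)},\dots$ originating from $\mathbf m$, one defines $\xi_{\mathbf m}=\lim_{i\to\infty}\alpha_{\mathbf m^{(i)}}$ (this limit exists). *)

theory Defs
  imports "HOL-Analysis.Analysis"
begin

subsection \<open>Words\<close>

type_synonym word = "nat list"

definition word_a :: word where "word_a = [1, 1]"
definition word_b :: word where "word_b = [2, 2]"

inductive_set W0 :: "word set" where
  empty: "[] \<in> W0"
| app_a: "w \<in> W0 \<Longrightarrow> word_a @ w \<in> W0"
| app_b: "w \<in> W0 \<Longrightarrow> word_b @ w \<in> W0"

text \<open>
  The endomorphism of \<open>W0\<close> sending \<open>word_a\<close> to \<open>p\<close> and \<open>word_b\<close> to \<open>q\<close>. Only its values
  on \<open>W0\<close> are meaningful; there, every block of two letters is \<open>word_a\<close> or \<open>word_b\<close>.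
\<close>
fun endo :: "word \<Rightarrow> word \<Rightarrow> word \<Rightarrow> word" where
  "endo p q (x # y # w) = (if x = 1 \<and> y = 1 then p else q) @ endo p q w"
| "endo p q _ = []"

definition endo_U :: "word \<Rightarrow> word" where "endo_U = endo (word_a @ word_b) word_b"
definition endo_V :: "word \<Rightarrow> word" where "endo_V = endo word_a (word_a @ word_b)"

text \<open>
  Endomorphisms act on the right in the mathematical notation, so the product \<open>\<phi> \<psi>\<close>
  (first \<open>\<phi>\<close>, then \<open>\<psi>\<close>) is the function \<open>\<psi> \<circ> \<phi>\<close>; in particular the product \<open>V U\<close>
  is \<open>endo_U \<circ> endo_V\<close>.
\<close>
inductive_set UV_products :: "(word \<Rightarrow> word) set" where
  one: "id \<in> UV_products"
| mult_U: "\<phi> \<in> UV_products \<Longrightarrow> endo_U \<circ> \<phi> \<in> UV_products"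
| mult_V: "\<phi> \<in> UV_products \<Longrightarrow> endo_V \<circ> \<phi> \<in> UV_products"

lemma W0_append: "u \<in> W0 \<Longrightarrow> v \<in> W0 \<Longrightarrow> u @ v \<in> W0"
  by (induction u rule: W0.induct) (auto intro: W0.intros)

lemma word_a_in_W0: "word_a \<in> W0" and word_b_in_W0: "word_b \<in> W0"
  using W0.intros by (metis append_Nil2)+

lemma endo_word_a: "endo p q word_a = p" and endo_word_b: "endo p q word_b = q"
  by (simp_all add: word_a_def word_b_def)

lemma endo_append: "u \<in> W0 \<Longrightarrow> endo p q (u @ v) = endo p q u @ endo p q v"
  by (induction u rule: W0.induct) (auto simp: word_a_def word_b_def)

lemma endo_closed: "w \<in> W0 \<Longrightarrow> p \<in> W0 \<Longrightarrow> q \<in> W0 \<Longrightarrow> endo p q w \<in> W0"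
  by (induction w rule: W0.induct)
    (auto simp: endo_append endo_word_a endo_word_b word_a_in_W0 word_b_in_W0
      intro: W0_append W0.intros)

lemma endo_unique:
  assumes "f [] = []" "\<And>u v. u \<in> W0 \<Longrightarrow> v \<in> W0 \<Longrightarrow> f (u @ v) = f u @ f v"
    and "f word_a = p" "f word_b = q" "w \<in> W0"
  shows "f w = endo p q w"
  using assms(5)
  by (induction w rule: W0.induct)
    (simp_all add: assms endo_append endo_word_a endo_word_b word_a_in_W0 word_b_in_W0)

definition is_prefix :: "word \<Rightarrow> (nat \<Rightarrow> nat) \<Rightarrow> bool" where
  "is_prefix w P \<longleftrightarrow> (\<forall>j < length w. w ! j = P j)"

subsection \<open>Continued fractions\<close>

text \<open>
  For irrational \<open>x\<close> with expansion \<open>[a\<^sub>0, a\<^sub>1, a\<^sub>2, \<dots>]\<close>, \<open>complete_quotient x n\<close> is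
  \<open>[a\<^sub>n, a\<^sub>n\<^sub>+\<^sub>1, \<dots>]\<close> and \<open>partial_quotient x n\<close> is \<open>a\<^sub>n\<close>. The conversion to \<open>nat\<close> loses
  nothing for \<open>x \<ge> 0\<close>.
\<close>
fun complete_quotient :: "real \<Rightarrow> nat \<Rightarrow> real" where
  "complete_quotient x 0 = x"
| "complete_quotient x (Suc n) =
     1 / (complete_quotient x n - of_int \<lfloor>complete_quotient x n\<rfloor>)"

definition partial_quotient :: "real \<Rightarrow> nat \<Rightarrow> nat" where
  "partial_quotient x n = nat \<lfloor>complete_quotient x n\<rfloor>"

subsection \<open>The Markoff tree and its zigzags\<close>

datatype side = Left | Right

fun other_side :: "side \<Rightarrow> side" where
  "other_side Left = Right"
| "other_side Right = Left"

type_synonym triple = "int \<times> int \<times> int"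

fun markoff_step :: "side \<Rightarrow> triple \<Rightarrow> triple" where
  "markoff_step Left (m, m1, m2) = (3 * m * m1 - m2, m1, m)"
| "markoff_step Right (m, m1, m2) = (3 * m * m2 - m1, m, m2)"

text \<open>
  The root \<open>(2, 1, 1)\<close> has only a left successor, which is
  \<open>markoff_step Left (2, 1, 1) = (5, 1, 2)\<close>.
\<close>
definition successor :: "side \<Rightarrow> triple \<Rightarrow> triple \<Rightarrow> bool" where
  "successor s n n' \<longleftrightarrow> n' = markoff_step s n \<and> (n = (2, 1, 1) \<longrightarrow> s = Left)"

inductive_set Sigma_star :: "triple set" where
  root: "(2, 1, 1) \<in> Sigma_star"
| succ: "n \<in> Sigma_star \<Longrightarrow> successor s n n' \<Longrightarrow> n' \<in> Sigma_star"

text \<open>Zigzags are indexed from \<open>0\<close>: \<open>z i\<close> is the \<open>(i+1)\<close>-st term.\<close>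

definition zigzag :: "(nat \<Rightarrow> triple) \<Rightarrow> bool" where
  "zigzag z \<longleftrightarrow> (\<forall>i. z i \<in> Sigma_star) \<and>
     (\<forall>i. \<exists>s. successor s (z i) (z (Suc i)) \<and>
              successor (other_side s) (z (Suc i)) (z (Suc (Suc i))))"

definition maximal_zigzag :: "(nat \<Rightarrow> triple) \<Rightarrow> bool" where
  "maximal_zigzag z \<longleftrightarrow> zigzag z \<and>
     \<not> (\<exists>n \<in> Sigma_star. (\<exists>s. successor s n (z 0)) \<and> zigzag (case_nat n z))"

definition zigzag_from :: "triple \<Rightarrow> nat \<Rightarrow> triple" where
  "zigzag_from m = (THE z. maximal_zigzag z \<and> z 0 = m)"

subsection \<open>The matrices and the numbers attached to the nodes\<close>

type_synonym mat2 = "int^2^2"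

definition mat22 :: "int \<Rightarrow> int \<Rightarrow> int \<Rightarrow> int \<Rightarrow> mat2" where
  "mat22 a b c d = vector [vector [a, b], vector [c, d]]"

definition mat_M :: mat2 where "mat_M = mat22 3 1 (-1) 0"

fun matrix_step :: "side \<Rightarrow> mat2 \<times> mat2 \<times> mat2 \<Rightarrow> mat2 \<times> mat2 \<times> mat2" where
  "matrix_step Left (x, x1, x2) = (x1 ** mat_M ** x, x1, x)"
| "matrix_step Right (x, x1, x2) = (x ** mat_M ** x2, x, x2)"

text \<open>
  A position in a binary tree is the list of sides taken on the way down from its root.
  The root of the first tree is \<open>(5, 1, 2)\<close>, not \<open>(2, 1, 1)\<close>.
\<close>
definition markoff_at :: "side list \<Rightarrow> triple" where
  "markoff_at p = foldl (\<lambda>n s. markoff_step s n) (5, 1, 2) p"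

definition matrix_at :: "side list \<Rightarrow> mat2 \<times> mat2 \<times> mat2" where
  "matrix_at p =
     foldl (\<lambda>n s. matrix_step s n) (mat22 5 3 3 2, mat22 1 1 1 2, mat22 2 1 1 1) p"

definition x_mat :: "triple \<Rightarrow> mat2" where
  "x_mat m = (if m = (2, 1, 1) then mat22 2 1 1 1
              else fst (matrix_at (THE p. markoff_at p = m)))"

definition alpha :: "triple \<Rightarrow> real" where
  "alpha n = (let m = of_int (fst n); k = of_int (x_mat n $ 1 $ 2)
              in (2 * k - 3 * m + sqrt (9 * m\<^sup>2 - 4)) / (2 * m))"

definition xi :: "triple \<Rightarrow> real" where
  "xi m = lim (\<lambda>i. alpha (zigzag_from m i))"

end

theory Submission
  imports Defs
begin

text \<open>
  Label the node of the Markoff tree reached from \<open>(5, 1, 2)\<close> by the path \<open>s\<^sub>1 \<dots> s\<^sub>n\<close>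
  with the word \<open>(ab)\<^bsup>\<psi>\<^esup>\<close>, where \<open>\<psi> = S\<^sub>n \<dots> S\<^sub>1\<close> and \<open>S\<^sub>i\<close> is \<open>V\<close> for a left step and
  \<open>U\<close> for a right step. The triple of matrices at that node, multiplied on the right by
  \<open>M\<close>, consists of the continuant matrices of \<open>(ab)\<^bsup>\<psi>\<^esup>\<close>, \<open>a\<^bsup>\<psi>\<^esup>\<close> and \<open>b\<^bsup>\<psi>\<^esup>\<close>
  (\<open>node_matrices\<close>). Consequently \<open>\<alpha>\<^sub>m\<close> is the number whose partial quotients after the
  initial \<open>0\<close> repeat the word of \<open>m\<close> periodically. What is used is that \<open>\<alpha>\<^sub>m\<close> lies in the
  cylinder of that word, the interval of all \<open>[0, a\<^sub>1, \<dots>, a\<^sub>n + t]\<close> with \<open>0 \<le> t \<le> 1\<close>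
  (\<open>alpha_in_cylinder\<close>).

  Follow the tree from the node of \<open>\<psi>\<close> by alternating right and left steps, a right step
  first. After \<open>2i\<close> steps the word is \<open>(ab)\<^bsup>(VU)\<^sup>i\<psi>\<^esup>\<close>, and it is a prefix of all later
  words, because \<open>(ab)\<^sup>U = abb\<close> and \<open>(ab)\<^bsup>VU\<^esup> = ababb\<close> begin with \<open>ab\<close>. The cylinders of these
  words are nested and closed, and their diameters tend to \<open>0\<close>. So the numbers \<open>\<alpha>\<close> along
  the way converge to the unique point common to all these cylinders
  (\<open>nested_cylinders_limit\<close>), and an irrational number of \<open>(0, 1)\<close> lies in the cylinder
  of a word exactly when the word is a prefix of its partial quotients
  (\<open>is_prefix_iff_cylinder\<close>).

  It remains to see that these limits, one for each product \<open>\<psi>\<close> of \<open>U\<close> and \<open>V\<close>, are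
  exactly the \<open>\<xi>\<^sub>m\<close> (\<open>xi_values_eq\<close>). The maximal zigzag from a node other than the root
  repeats first the side by which the node was reached; the one from the root starts on the
  left. Discarding its first node if it starts on the left, every maximal zigzag becomes one
  of the walks above. Conversely, such a walk arises in this way unless its path ends in a
  right step followed by a left step; these two steps may then be removed from the path,
  since that only prepends two nodes to the walk and does not change its limit.
\<close>

section \<open>Cylinders of continued fractions\<close>

text \<open>\<open>cf_val [a\<^sub>1, \<dots>, a\<^sub>n] t\<close> is the continued fraction \<open>[0, a\<^sub>1, \<dots>, a\<^sub>n + t]\<close>.\<close>

fun cf_val :: "word \<Rightarrow> real \<Rightarrow> real" where
  "cf_val [] t = t"
| "cf_val (a # w) t = 1 / (real a + cf_val w t)"

text \<open>
  The numbers in \<open>[0, 1]\<close> whose expansion starts with \<open>w\<close>, with both end points included so that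
  the set is compact.
\<close>

definition cylinder :: "word \<Rightarrow> real set" where
  "cylinder w = cf_val w ` {0..1}"

abbreviation positive_word :: "word \<Rightarrow> bool" where
  "positive_word w \<equiv> \<forall>a \<in> set w. 1 \<le> a"

lemma cf_val_append: "cf_val (u @ v) t = cf_val u (cf_val v t)"
  by (induction u) auto

lemma cf_val_bounds:
  assumes "positive_word w" "0 \<le> t" "t \<le> 1"
  shows "0 \<le> cf_val w t \<and> cf_val w t \<le> 1"
  using assms by (induction w) (auto simp: field_simps)

lemma cylinder_append:
  assumes "positive_word v"
  shows "cylinder (u @ v) \<subseteq> cylinder u"
  using cf_val_bounds[OF assms] by (force simp: cylinder_def cf_val_append)

text \<open>
  For the letter \<open>1\<close> alone the map \<open>t \<mapsto> 1 / (1 + t)\<close> has slope \<open>-1\<close> at \<open>0\<close>; two consecutive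
  letters contract distances by a factor of at least \<open>4\<close>.
\<close>

lemma cf_val_contraction:
  assumes "positive_word w" "s \<in> {0..1}" "t \<in> {0..1}"
  shows "\<bar>cf_val w s - cf_val w t\<bar> \<le> 2 * (1/2) ^ length w"
  using assms
proof (induction w rule: induct_list012)
  case 1
  then show ?case by auto
next
  case (2 a)
  then have "0 \<le> cf_val [a] s" "cf_val [a] s \<le> 1" "0 \<le> cf_val [a] t" "cf_val [a] t \<le> 1"
    using cf_val_bounds[of "[a]"] by auto
  then have "\<bar>cf_val [a] s - cf_val [a] t\<bar> \<le> 1" by linarith
  then show ?case by simp
next
  case (3 a b w)
  define x y where "x = cf_val w s" and "y = cf_val w t"
  define c d where "c = real a" and "d = real b"
  have xy: "0 \<le> x" "0 \<le> y" and cd: "1 \<le> c" "1 \<le> d"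
    using 3 cf_val_bounds[of w] by (auto simp: x_def y_def c_def d_def)
  have pos: "c * (d + z) + 1 \<ge> 2" if "0 \<le> z" for z
    using mult_mono[of 1 c 1 "d + z"] cd that by auto
  have val: "1 / (c + 1 / (d + z)) = (d + z) / (c * (d + z) + 1)" if "0 \<le> z" for z
    using that cd by (simp add: field_simps)
  have diff: "cf_val (a # b # w) s - cf_val (a # b # w) t
      = (x - y) / ((c * (d + x) + 1) * (c * (d + y) + 1))"
  proof -
    have "cf_val (a # b # w) s - cf_val (a # b # w) t
        = (d + x) / (c * (d + x) + 1) - (d + y) / (c * (d + y) + 1)"
      using val[of x] val[of y] xy by (simp add: x_def y_def c_def d_def)
    also have "\<dots> = ((d + x) * (c * (d + y) + 1) - (d + y) * (c * (d + x) + 1))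
        / ((c * (d + x) + 1) * (c * (d + y) + 1))"
      using pos[of x] pos[of y] xy by (subst diff_frac_eq) auto
    also have "(d + x) * (c * (d + y) + 1) - (d + y) * (c * (d + x) + 1) = x - y"
      by (simp add: algebra_simps)
    finally show ?thesis .
  qed
  have "4 \<le> (c * (d + x) + 1) * (c * (d + y) + 1)"
    using mult_mono[of 2 "c * (d + x) + 1" 2 "c * (d + y) + 1"] pos[of x] pos[of y] xy by auto
  then have "\<bar>cf_val (a # b # w) s - cf_val (a # b # w) t\<bar> \<le> \<bar>x - y\<bar> / 4"
    unfolding diff abs_divide by (intro divide_left_mono) auto
  also have "\<dots> \<le> (2 * (1/2) ^ length w) / 4"
    using 3 by (intro divide_right_mono) (auto simp: x_def y_def)
  finally show ?case by simp
qed

lemma cylinder_diameter: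
  assumes "positive_word w" "x \<in> cylinder w" "y \<in> cylinder w"
  shows "\<bar>x - y\<bar> \<le> 2 * (1/2) ^ length w"
  using assms cf_val_contraction by (auto simp: cylinder_def)

lemma closed_cylinder:
  assumes "positive_word w"
  shows "closed (cylinder w)"
proof -
  have "continuous_on {0..1} (cf_val w)"
    using assms
  proof (induction w)
    case (Cons a w)
    have "real a + cf_val w t \<noteq> 0" if "t \<in> {0..1}" for t
      using cf_val_bounds[of w t] Cons.prems that by auto
    then show ?case
      using Cons by (auto intro!: continuous_on_divide continuous_on_add continuous_on_const)
  qed auto
  then show ?thesis
    unfolding cylinder_def by (intro compact_imp_closed compact_continuous_image) auto
qed

text \<open>Deleting the first partial quotient of a number in \<open>(0, 1)\<close> is the Gauss map.\<close>

lemma partial_quotient_Gauss: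
  assumes "0 < x" "x < 1" "0 < frac (1 / x)"
  shows "partial_quotient x (Suc (Suc n)) = partial_quotient (frac (1 / x)) (Suc n)"
proof -
  have x: "\<lfloor>x\<rfloor> = 0" "\<lfloor>frac (1 / x)\<rfloor> = 0"
    using assms frac_lt_1[of "1 / x"] by (auto simp: floor_eq_iff)
  have "complete_quotient x (Suc (Suc n)) = complete_quotient (frac (1 / x)) (Suc n)"
    by (induction n) (use x in \<open>simp_all add: frac_def\<close>)
  then show ?thesis by (simp add: partial_quotient_def)
qed

lemma is_prefix_Cons: "is_prefix (a # w) P \<longleftrightarrow> a = P 0 \<and> is_prefix w (\<lambda>j. P (Suc j))"
  by (auto simp: is_prefix_def less_Suc_eq_0_disj)

text \<open>
  Irrationality keeps \<open>x\<close> and its images under the Gauss map away from the end points of the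
  cylinders, which adjacent cylinders of equal length share.
\<close>

lemma is_prefix_iff_cylinder:
  assumes "positive_word w" "x \<notin> \<rat>" "0 < x" "x < 1"
  shows "is_prefix w (\<lambda>j. partial_quotient x (Suc j)) \<longleftrightarrow> x \<in> cylinder w"
  using assms
proof (induction w arbitrary: x)
  case Nil
  then show ?case by (auto simp: is_prefix_def cylinder_def)
next
  case (Cons a w)
  define y where "y = frac (1 / x)"
  have inv: "1 / x \<notin> \<rat>"
    using Cons.prems Rats_divide[OF Rats_1, of "1 / x"] by auto
  have y_irr: "y \<notin> \<rat>"
    using inv Rats_add[of y "of_int \<lfloor>1 / x\<rfloor>"] by (auto simp: y_def frac_def)
  then have "y \<noteq> 0" by auto
  then have y: "0 < y" "y < 1"
    using frac_ge_0[of "1 / x"] frac_lt_1[of "1 / x"] unfolding y_def by linarith+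
  have first: "partial_quotient x (Suc 0) = nat \<lfloor>1 / x\<rfloor>"
  proof -
    have "\<lfloor>x\<rfloor> = 0" using Cons.prems by (auto simp: floor_eq_iff)
    then show ?thesis by (simp add: partial_quotient_def)
  qed
  have "is_prefix (a # w) (\<lambda>j. partial_quotient x (Suc j))
      \<longleftrightarrow> a = nat \<lfloor>1 / x\<rfloor> \<and> y \<in> cylinder w"
    using Cons.IH[of y] Cons.prems y y_irr first
    by (simp add: is_prefix_Cons partial_quotient_Gauss y_def)
  also have "\<dots> \<longleftrightarrow> x \<in> cylinder (a # w)"
  proof
    assume h: "a = nat \<lfloor>1 / x\<rfloor> \<and> y \<in> cylinder w"
    then obtain t where t: "t \<in> {0..1}" "y = cf_val w t" by (auto simp: cylinder_def)
    have "real a = of_int \<lfloor>1 / x\<rfloor>" using h Cons.prems by simp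
    then have "1 / x = real a + cf_val w t" using t by (simp add: y_def frac_def)
    then have "x = 1 / (real a + cf_val w t)" by (metis div_by_1 divide_divide_eq_right mult_1)
    then show "x \<in> cylinder (a # w)" using t by (auto simp: cylinder_def)
  next
    assume "x \<in> cylinder (a # w)"
    then obtain t where t: "t \<in> {0..1}" "x = 1 / (real a + cf_val w t)"
      by (auto simp: cylinder_def)
    define z where "z = cf_val w t"
    have z: "1 / x = real a + z" using t by (simp add: z_def)
    have "0 \<le> z" "z \<le> 1" using cf_val_bounds[of w t] Cons.prems t by (auto simp: z_def)
    moreover have "z \<noteq> 1" using z inv by auto
    ultimately have fl: "\<lfloor>1 / x\<rfloor> = int a" using z by (simp add: floor_eq_iff)
    then have "y = z" using z by (simp add: y_def frac_def)
    then show "a = nat \<lfloor>1 / x\<rfloor> \<and> y \<in> cylinder w"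
      using fl t by (auto simp: cylinder_def z_def)
  qed
  finally show ?case .
qed

text \<open>
  The bound \<open>2 * i\<close> is chosen for the application, where every second point comes with a new word.
\<close>

lemma nested_cylinders_limit:
  fixes w :: "nat \<Rightarrow> word" and x :: "nat \<Rightarrow> real"
  assumes pos: "\<And>i. positive_word (w i)"
    and len: "\<And>i. i \<le> length (w i)"
    and mem: "\<And>i j. 2 * i \<le> j \<Longrightarrow> x j \<in> cylinder (w i)"
  shows "convergent x" and "\<xi> = lim x \<longleftrightarrow> (\<forall>i. \<xi> \<in> cylinder (w i))"
proof -
  have small: "\<exists>i. \<forall>u\<in>cylinder (w i). \<forall>v\<in>cylinder (w i). \<bar>u - v\<bar> < e" if "e > 0" for e
  proof -
    obtain i where i: "(1/2 :: real) ^ i < e / 2"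
      using real_arch_pow_inv[of "e / 2" "1/2"] \<open>e > 0\<close> by auto
    have "\<bar>u - v\<bar> < e" if "u \<in> cylinder (w i)" "v \<in> cylinder (w i)" for u v
    proof -
      have "\<bar>u - v\<bar> \<le> 2 * (1/2) ^ length (w i)"
        using cylinder_diameter[OF pos that] .
      also have "\<dots> \<le> 2 * (1/2) ^ i"
        using len[of i] by (intro mult_left_mono power_decreasing) auto
      finally show ?thesis using i by simp
    qed
    then show ?thesis by blast
  qed
  show conv: "convergent x"
  proof (rule real_Cauchy_convergent, rule metric_CauchyI)
    fix e :: real assume "e > 0"
    then show "\<exists>M. \<forall>m\<ge>M. \<forall>n\<ge>M. dist (x m) (x n) < e"
      using small mem unfolding dist_real_def by metis
  qed
  show "\<xi> = lim x \<longleftrightarrow> (\<forall>i. \<xi> \<in> cylinder (w i))"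
  proof
    assume \<xi>: "\<xi> = lim x"
    have "x \<longlonglongrightarrow> \<xi>" using conv \<xi> by (simp add: convergent_LIMSEQ_iff)
    moreover have "eventually (\<lambda>j. x j \<in> cylinder (w i)) sequentially" for i
      using mem by (auto simp: eventually_sequentially)
    ultimately show "\<forall>i. \<xi> \<in> cylinder (w i)"
      using closed_cylinder[OF pos] by (intro allI Lim_in_closed_set) auto
  next
    assume all: "\<forall>i. \<xi> \<in> cylinder (w i)"
    have "x \<longlonglongrightarrow> \<xi>"
    proof (rule metric_LIMSEQ_I)
      fix e :: real assume "e > 0"
      then show "\<exists>M. \<forall>n\<ge>M. dist (x n) \<xi> < e"
        using small mem all unfolding dist_real_def by metis
    qed
    then show "\<xi> = lim x" by (simp add: limI)
  qed
qed

section \<open>Continuant matrices\<close>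

text \<open>
  The continuant matrix of a word, that is, the product of the matrices with rows \<open>(a\<^sub>i, 1)\<close> and
  \<open>(1, 0)\<close>. If its rows are \<open>(p, q)\<close> and \<open>(r, s)\<close>, then \<open>cf_val w t = (r + s t) / (p + q t)\<close>.
\<close>

fun cf_mat :: "word \<Rightarrow> mat2" where
  "cf_mat [] = mat22 1 0 0 1"
| "cf_mat (a # w) = mat22 (int a) 1 1 0 ** cf_mat w"

lemma mat22_mult:
  "mat22 a b c d ** mat22 a' b' c' d'
    = mat22 (a * a' + b * c') (a * b' + b * d') (c * a' + d * c') (c * b' + d * d')"
  by (simp add: mat22_def matrix_matrix_mult_def vec_eq_iff forall_2 sum_2)

lemma mat22_nth [simp]:
  "mat22 a b c d $ 1 $ 1 = a" "mat22 a b c d $ 1 $ 2 = b"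
  "mat22 a b c d $ 2 $ 1 = c" "mat22 a b c d $ 2 $ 2 = d"
  by (simp_all add: mat22_def)

lemma mat22_eq_iff: "mat22 a b c d = mat22 a' b' c' d' \<longleftrightarrow> a = a' \<and> b = b' \<and> c = c' \<and> d = d'"
  by (metis mat22_nth)

lemma mat22_cases: obtains a b c d where "A = mat22 a b c d"
proof
  show "A = mat22 (A $ 1 $ 1) (A $ 1 $ 2) (A $ 2 $ 1) (A $ 2 $ 2)"
    by (simp add: mat22_def vec_eq_iff forall_2)
qed

lemma cf_mat_append: "cf_mat (u @ v) = cf_mat u ** cf_mat v"
proof (induction u)
  case Nil
  then show ?case by (cases "cf_mat v" rule: mat22_cases) (simp add: mat22_mult)
qed (simp add: matrix_mul_assoc)

lemma cf_mat_bounds: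
  assumes "positive_word w" "cf_mat w = mat22 p q r s"
  shows "0 \<le> r \<and> 0 \<le> s \<and> 0 \<le> q \<and> 1 \<le> p \<and> r + s \<le> p + q"
  using assms
proof (induction w arbitrary: p q r s)
  case (Cons a w)
  obtain p' q' r' s' where C: "cf_mat w = mat22 p' q' r' s'" by (rule mat22_cases)
  have ih: "0 \<le> r'" "0 \<le> s'" "1 \<le> p'" "0 \<le> q'" using Cons.IH[OF _ C] Cons.prems by auto
  have eqs: "p = int a * p' + r'" "q = int a * q' + s'" "r = p'" "s = q'"
    using Cons.prems C by (auto simp: mat22_mult mat22_eq_iff)
  have "p' \<le> int a * p'" "q' \<le> int a * q'"
    using mult_right_mono[of 1 "int a" p'] mult_right_mono[of 1 "int a" q'] Cons.prems ih
    by auto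
  then show ?case using eqs ih by linarith
qed (simp add: mat22_eq_iff)

lemma cf_val_eq_cf_mat:
  assumes "positive_word w" "0 \<le> t" "cf_mat w = mat22 p q r s"
  shows "cf_val w t = (r + s * t) / (p + q * t)"
  using assms
proof (induction w arbitrary: p q r s)
  case (Cons a w)
  obtain p' q' r' s' where C: "cf_mat w = mat22 p' q' r' s'" by (rule mat22_cases)
  have "0 \<le> q'" "1 \<le> p'" using cf_mat_bounds[OF _ C] Cons.prems by auto
  then have pos: "real_of_int p' + q' * t > 0"
    using Cons.prems by (intro add_pos_nonneg) auto
  have eqs: "p = int a * p' + r'" "q = int a * q' + s'" "r = p'" "s = q'"
    using Cons.prems C by (auto simp: mat22_mult mat22_eq_iff)
  have "cf_val w t = (r' + s' * t) / (p' + q' * t)"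
    using Cons.IH[OF _ _ C] Cons.prems by auto
  then have "real a + cf_val w t = (p + q * t) / (p' + q' * t)"
    using pos by (simp add: eqs field_simps)
  then show ?case by (simp add: eqs)
qed (simp add: mat22_eq_iff)

text \<open>
  The number is the larger root \<open>t\<close> of \<open>q t\<^sup>2 + (p - s) t - r = 0\<close>, the equation
  \<open>cf_val w t = t\<close>. It belongs to \<open>[0, 1]\<close> by the inequalities between the entries of the
  continuant matrix.
\<close>

lemma quadratic_irrational_in_cylinder:
  fixes p q r s :: int
  assumes w: "positive_word w" "cf_mat w = mat22 p q r s"
    and det: "p * s - q * r = 1" and q: "0 < q"
  shows "(s - p + sqrt ((p + s)\<^sup>2 - 4)) / (2 * q) \<in> cylinder w"
proof -
  define P Q R S where "P = real_of_int p" and "Q = real_of_int q"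
    and "R = real_of_int r" and "S = real_of_int s"
  have bounds: "0 \<le> R" "0 \<le> S" "1 \<le> P" "R + S \<le> P + Q" "0 < Q"
    using cf_mat_bounds[OF w] q by (auto simp: P_def Q_def R_def S_def)
  have detR: "P * S - Q * R = 1"
    using det unfolding P_def Q_def R_def S_def by (metis of_int_1 of_int_diff of_int_mult)
  define d where "d = sqrt ((P + S)\<^sup>2 - 4)"
  define t where "t = (S - P + d) / (2 * Q)"
  have disc: "(P + S)\<^sup>2 - 4 = (P - S)\<^sup>2 + 4 * (Q * R)"
    using detR by (simp add: power2_eq_square algebra_simps)
  then have d2: "d\<^sup>2 = (P - S)\<^sup>2 + 4 * (Q * R)" "0 \<le> d"
    using bounds by (auto simp: d_def)
  have t0: "0 \<le> t"
  proof -
    have "(P - S)\<^sup>2 \<le> d\<^sup>2" using d2 bounds by simp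
    then have "P - S \<le> d" using d2(2) by (rule power2_le_imp_le)
    then show ?thesis using bounds by (simp add: t_def)
  qed
  have t1: "t \<le> 1"
  proof -
    have "Q * R \<le> Q * (P + Q - S)" using bounds by (intro mult_left_mono) auto
    then have "d\<^sup>2 \<le> (2 * Q + P - S)\<^sup>2"
      unfolding d2(1) by (simp add: power2_eq_square algebra_simps)
    moreover have "0 \<le> 2 * Q + P - S" using bounds by linarith
    ultimately have "d \<le> 2 * Q + P - S" by (rule power2_le_imp_le)
    then show ?thesis using bounds by (simp add: t_def)
  qed
  have dt: "d = 2 * Q * t + P - S" using bounds by (simp add: t_def)
  have "Q * (R + S * t) = Q * (t * (P + Q * t))"
    using d2(1) unfolding dt by (simp add: power2_eq_square algebra_simps)
  then have root: "R + S * t = t * (P + Q * t)" using bounds by simp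
  moreover have "P + Q * t > 0" using bounds t0 by (intro add_pos_nonneg) auto
  ultimately have "cf_val w t = t"
    using cf_val_eq_cf_mat[OF w(1) t0 w(2)] by (simp add: P_def Q_def R_def S_def)
  then have "t \<in> cylinder w" using t0 t1 unfolding cylinder_def by force
  then show ?thesis by (simp add: t_def d_def P_def Q_def R_def S_def)
qed

section \<open>Words at the nodes of the tree\<close>

text \<open>
  A left step replaces the words \<open>(w\<^sub>1, w\<^sub>2)\<close> attached to the last two components of a node by
  \<open>(w\<^sub>1, w\<^sub>1 w\<^sub>2)\<close>, a right step by \<open>(w\<^sub>1 w\<^sub>2, w\<^sub>2)\<close>. When these words are the images of \<open>a\<close> and \<open>b\<close>
  under \<open>\<psi>\<close>, the new ones are their images under \<open>V\<psi>\<close> and \<open>U\<psi>\<close> respectively; so the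
  endomorphism of the last step of a path is applied first.
\<close>

primrec side_endo :: "side \<Rightarrow> word \<Rightarrow> word" where
  "side_endo Left = endo_V"
| "side_endo Right = endo_U"

primrec path_endo :: "side list \<Rightarrow> word \<Rightarrow> word" where
  "path_endo [] = id"
| "path_endo (s # p) = side_endo s \<circ> path_endo p"

lemma path_endo_append: "path_endo (p @ q) = path_endo p \<circ> path_endo q"
  by (induction p) (auto simp: comp_assoc)

lemma UV_products_eq: "UV_products = range path_endo"
proof
  show "UV_products \<subseteq> range path_endo"
  proof
    fix \<phi> assume "\<phi> \<in> UV_products"
    then show "\<phi> \<in> range path_endo"
    proof induction
      case one
      then show ?case by (rule range_eqI[of _ _ "[]"]) simp
    next
      case (mult_U \<phi>)
      then obtain p where "\<phi> = path_endo p" by blast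
      then have "endo_U \<circ> \<phi> = path_endo (Right # p)" by simp
      then show ?case by (rule range_eqI)
    next
      case (mult_V \<phi>)
      then obtain p where "\<phi> = path_endo p" by blast
      then have "endo_V \<circ> \<phi> = path_endo (Left # p)" by simp
      then show ?case by (rule range_eqI)
    qed
  qed
  have "path_endo p \<in> UV_products" for p
  proof (induction p)
    case Nil
    then show ?case unfolding path_endo.simps by (rule UV_products.one)
  next
    case (Cons s p)
    then show ?case
      unfolding path_endo.simps
      by (cases s) (simp_all only: side_endo.simps UV_products.mult_U UV_products.mult_V)
  qed
  then show "range path_endo \<subseteq> UV_products" by blast
qed

lemma W0_positive: "w \<in> W0 \<Longrightarrow> positive_word w"
  by (induction rule: W0.induct) (auto simp: word_a_def word_b_def)

lemma W0_ab: "word_a @ word_b \<in> W0"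
  by (simp add: W0_append word_a_in_W0 word_b_in_W0)

lemma side_endo_a_b:
  "side_endo Left word_a = word_a" "side_endo Left word_b = word_a @ word_b"
  "side_endo Right word_a = word_a @ word_b" "side_endo Right word_b = word_b"
  by (simp_all add: endo_U_def endo_V_def endo_word_a endo_word_b)

lemma side_endo_W0: "w \<in> W0 \<Longrightarrow> side_endo s w \<in> W0"
  by (cases s) (simp_all add: endo_U_def endo_V_def endo_closed W0_ab word_a_in_W0 word_b_in_W0)

lemma side_endo_append: "u \<in> W0 \<Longrightarrow> side_endo s (u @ v) = side_endo s u @ side_endo s v"
  by (cases s) (simp_all add: endo_U_def endo_V_def endo_append)

lemma path_endo_W0: "w \<in> W0 \<Longrightarrow> path_endo p w \<in> W0"
  by (induction p) (auto simp: side_endo_W0)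

lemma path_endo_append_word:
  "u \<in> W0 \<Longrightarrow> path_endo p (u @ v) = path_endo p u @ path_endo p v"
  by (induction p) (auto simp: side_endo_append path_endo_W0)

lemma length_side_endo: "w \<in> W0 \<Longrightarrow> length w \<le> length (side_endo s w)"
proof (induction rule: W0.induct)
  case (app_a w)
  then show ?case by (cases s) (simp_all add: side_endo_append side_endo_a_b word_a_in_W0 del: side_endo.simps)
next
  case (app_b w)
  then show ?case by (cases s) (simp_all add: side_endo_append side_endo_a_b word_b_in_W0 del: side_endo.simps)
qed simp

lemma length_path_endo: "w \<in> W0 \<Longrightarrow> length w \<le> length (path_endo p w)"
proof (induction p)
  case (Cons s p)
  then show ?case using length_side_endo[of "path_endo p w" s] path_endo_W0[of w p] by simp
qed simp

text \<open>
  The word attached to the node at position \<open>p\<close>, that is, to its first component. It is the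
  concatenation of the words \<open>path_endo p word_a\<close> and \<open>path_endo p word_b\<close> attached to the other
  two components.
\<close>

definition node_word :: "side list \<Rightarrow> word" where
  "node_word p = path_endo p (word_a @ word_b)"

lemma node_word_W0: "node_word p \<in> W0"
  by (simp add: node_word_def path_endo_W0 W0_ab)

lemma positive_node_word: "positive_word (node_word p)"
  by (rule W0_positive[OF node_word_W0])

lemma node_word_Right: "node_word (p @ [Right]) = node_word p @ path_endo p word_b"
  by (simp add: node_word_def path_endo_append side_endo_a_b(3,4)[unfolded side_endo.simps]
      side_endo_append[of _ Right, unfolded side_endo.simps] path_endo_append_word[OF W0_ab]
      word_a_in_W0 path_endo_append_word del: append_assoc)

lemma node_word_Right_Left:
  "node_word (p @ [Right, Left]) = node_word p @ node_word (p @ [Right])"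
proof -
  have "side_endo Right (side_endo Left (word_a @ word_b))
      = (word_a @ word_b) @ side_endo Right (word_a @ word_b)"
    by (simp add: side_endo_append side_endo_a_b word_a_in_W0 del: side_endo.simps)
  then show ?thesis
    by (simp add: node_word_def path_endo_append path_endo_append_word[OF W0_ab]
        del: side_endo.simps append_assoc)
qed

section \<open>Matrices at the nodes of the tree\<close>

lemma markoff_at_append: "markoff_at (p @ [s]) = markoff_step s (markoff_at p)"
  and matrix_at_append: "matrix_at (p @ [s]) = matrix_step s (matrix_at p)"
  by (simp_all add: markoff_at_def matrix_at_def)

lemma cf_mat_a_b: "cf_mat word_a = mat22 2 1 1 1" "cf_mat word_b = mat22 5 2 2 1"
  by (simp_all add: word_a_def word_b_def mat22_mult)

text \<open>
  In the next three lemmas the symmetric matrices with entries \<open>m, k, l\<close> are the components of a node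
  of the matrix tree. The first component is the product, with \<open>M\<close> in between, of the other two.
\<close>

lemma symmetric_product_entries:
  assumes "mat22 m k k l = mat22 m1 k1 k1 l1 ** mat_M ** mat22 m2 k2 k2 l2"
  shows "m = (3 * m1 - k1) * m2 + m1 * k2" "k = (3 * m1 - k1) * k2 + m1 * l2"
    "k = (3 * k1 - l1) * m2 + k1 * k2" "l = (3 * k1 - l1) * k2 + k1 * l2"
  using assms by (simp_all add: mat_M_def mat22_mult mat22_eq_iff algebra_simps)

lemma symmetric_product_det:
  assumes "mat22 m k k l = mat22 m1 k1 k1 l1 ** mat_M ** mat22 m2 k2 k2 l2"
    and "m1 * l1 - k1 * k1 = 1" "m2 * l2 - k2 * k2 = 1"
  shows "m * l - k * k = 1"
proof -
  have "m * l - k * k = ((3 * m1 - k1) * m2 + m1 * k2) * ((3 * k1 - l1) * k2 + k1 * l2)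
      - ((3 * m1 - k1) * k2 + m1 * l2) * ((3 * k1 - l1) * m2 + k1 * k2)"
    using symmetric_product_entries[OF assms(1)] by metis
  also have "\<dots> = (m1 * l1 - k1 * k1) * (m2 * l2 - k2 * k2)"
    by (simp add: algebra_simps)
  finally show ?thesis using assms by simp
qed

text \<open>
  Besides the matrices and their words, the induction carries along that the upper left entries are
  the Markoff triple, and that the determinants are \<open>1\<close>; together with \<open>x = x\<^sub>1 M x\<^sub>2\<close> these
  give the symmetry of the new matrix and the recursion for its upper left entry.
\<close>

lemma node_matrices:
  "\<exists>m k l m1 k1 l1 m2 k2 l2.
     markoff_at p = (m, m1, m2) \<and>
     matrix_at p = (mat22 m k k l, mat22 m1 k1 k1 l1, mat22 m2 k2 k2 l2) \<and>
     mat22 m k k l = mat22 m1 k1 k1 l1 ** mat_M ** mat22 m2 k2 k2 l2 \<and>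
     m1 * l1 - k1 * k1 = 1 \<and> m2 * l2 - k2 * k2 = 1 \<and>
     cf_mat (path_endo p word_a) = mat22 m1 k1 k1 l1 ** mat_M \<and>
     cf_mat (path_endo p word_b) = mat22 m2 k2 k2 l2 ** mat_M"
proof (induction p rule: rev_induct)
  case Nil
  have node: "markoff_at [] = (5, 1, 2) \<and>
      matrix_at [] = (mat22 5 3 3 2, mat22 1 1 1 2, mat22 2 1 1 1) \<and>
      mat22 5 3 3 2 = mat22 1 1 1 2 ** mat_M ** mat22 2 1 1 1 \<and>
      1 * 2 - 1 * 1 = (1 :: int) \<and> 2 * 1 - 1 * 1 = (1 :: int) \<and>
      cf_mat (path_endo [] word_a) = mat22 1 1 1 2 ** mat_M \<and>
      cf_mat (path_endo [] word_b) = mat22 2 1 1 1 ** mat_M"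
    by (simp add: markoff_at_def matrix_at_def mat_M_def mat22_mult cf_mat_a_b mat22_eq_iff)
  show ?case by (rule exI)+ (rule node)
next
  case (snoc s p)
  then obtain m k l m1 k1 l1 m2 k2 l2 where
    node: "markoff_at p = (m, m1, m2)"
      "matrix_at p = (mat22 m k k l, mat22 m1 k1 k1 l1, mat22 m2 k2 k2 l2)" and
    x: "mat22 m k k l = mat22 m1 k1 k1 l1 ** mat_M ** mat22 m2 k2 k2 l2" and
    det: "m1 * l1 - k1 * k1 = 1" "m2 * l2 - k2 * k2 = 1" and
    word: "cf_mat (path_endo p word_a) = mat22 m1 k1 k1 l1 ** mat_M"
      "cf_mat (path_endo p word_b) = mat22 m2 k2 k2 l2 ** mat_M"
    by blast
  note entries = symmetric_product_entries[OF x]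
  note det_x = symmetric_product_det[OF x det]
  have word_ab: "cf_mat (path_endo p (word_a @ word_b)) = mat22 m k k l ** mat_M"
    by (simp add: path_endo_append_word word_a_in_W0 cf_mat_append word x matrix_mul_assoc)
  show ?case
  proof (cases s)
    case Left
    define m' k' l' where "m' = 3 * m * m1 - m2" and "k' = (3 * m1 - k1) * k + m1 * l"
      and "l' = (3 * k1 - l1) * k + k1 * l"
    have "m1 * k - k1 * m = - m2 * (m1 * l1 - k1 * k1)"
      unfolding entries(3) entries(1) by (simp add: algebra_simps)
    then have e1: "m1 * k - k1 * m = - m2" using det by simp
    have "l1 * m - k1 * k = (3 * m2 + k2) * (m1 * l1 - k1 * k1)"
      unfolding entries(3) entries(1) by (simp add: algebra_simps)
    then have e2: "l1 * m - k1 * k = 3 * m2 + k2" using det by simp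
    have "m1 * l - k1 * k = - k2 * (m1 * l1 - k1 * k1)"
      unfolding entries(2) entries(4) by (simp add: algebra_simps)
    then have e3: "m1 * l - k1 * k = - k2" using det by simp
    have "(3 * m1 - k1) * m + m1 * k = m'"
      using e1 by (simp add: m'_def algebra_simps)
    moreover have "(3 * k1 - l1) * m + k1 * k = k'"
      using e1 e2 e3 by (simp add: k'_def algebra_simps)
    ultimately have x': "mat22 m1 k1 k1 l1 ** mat_M ** mat22 m k k l = mat22 m' k' k' l'"
      by (simp add: mat_M_def mat22_mult mat22_eq_iff k'_def l'_def algebra_simps)
    have node': "markoff_at (p @ [s]) = (m', m1, m) \<and>
      matrix_at (p @ [s]) = (mat22 m' k' k' l', mat22 m1 k1 k1 l1, mat22 m k k l) \<and>
      mat22 m' k' k' l' = mat22 m1 k1 k1 l1 ** mat_M ** mat22 m k k l \<and>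
      m1 * l1 - k1 * k1 = 1 \<and> m * l - k * k = 1 \<and>
      cf_mat (path_endo (p @ [s]) word_a) = mat22 m1 k1 k1 l1 ** mat_M \<and>
      cf_mat (path_endo (p @ [s]) word_b) = mat22 m k k l ** mat_M"
      using node x' det det_x word word_ab Left
      by (simp add: markoff_at_append matrix_at_append m'_def path_endo_append side_endo_a_b
          del: side_endo.simps)
    show ?thesis by (rule exI)+ (rule node')
  next
    case Right
    define m' k' l' where "m' = 3 * m * m2 - m1" and "k' = (3 * m - k) * k2 + m * l2"
      and "l' = (3 * k - l) * k2 + k * l2"
    have "m * k2 - k * m2 = - m1 * (m2 * l2 - k2 * k2)"
      unfolding entries(2) entries(1) by (simp add: algebra_simps)
    then have e1: "m * k2 - k * m2 = - m1" using det by simp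
    have "m * l2 - k * k2 = (3 * m1 - k1) * (m2 * l2 - k2 * k2)"
      unfolding entries(2) entries(1) by (simp add: algebra_simps)
    then have e2: "m * l2 - k * k2 = 3 * m1 - k1" using det by simp
    have "l * m2 - k * k2 = k1 * (m2 * l2 - k2 * k2)"
      unfolding entries(3) entries(4) by (simp add: algebra_simps)
    then have e3: "l * m2 - k * k2 = k1" using det by simp
    have "(3 * m - k) * m2 + m * k2 = m'"
      using e1 by (simp add: m'_def algebra_simps)
    moreover have "(3 * k - l) * m2 + k * k2 = k'"
      using e1 e2 e3 by (simp add: k'_def algebra_simps)
    ultimately have x': "mat22 m k k l ** mat_M ** mat22 m2 k2 k2 l2 = mat22 m' k' k' l'"
      by (simp add: mat_M_def mat22_mult mat22_eq_iff k'_def l'_def algebra_simps)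
    have node': "markoff_at (p @ [s]) = (m', m, m2) \<and>
      matrix_at (p @ [s]) = (mat22 m' k' k' l', mat22 m k k l, mat22 m2 k2 k2 l2) \<and>
      mat22 m' k' k' l' = mat22 m k k l ** mat_M ** mat22 m2 k2 k2 l2 \<and>
      m * l - k * k = 1 \<and> m2 * l2 - k2 * k2 = 1 \<and>
      cf_mat (path_endo (p @ [s]) word_a) = mat22 m k k l ** mat_M \<and>
      cf_mat (path_endo (p @ [s]) word_b) = mat22 m2 k2 k2 l2 ** mat_M"
      using node x' det det_x word word_ab Right
      by (simp add: markoff_at_append matrix_at_append m'_def path_endo_append side_endo_a_b
          del: side_endo.simps)
    show ?thesis by (rule exI)+ (rule node')
  qed
qed

section \<open>Positions and zigzags in the Markoff tree\<close>

text \<open>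
  The first component of a node is its strict maximum. This order makes the side and the predecessor
  of a node unique: the larger of the last two components is the first component of the predecessor.
\<close>

fun ordered_triple :: "triple \<Rightarrow> bool" where
  "ordered_triple (m, m1, m2) \<longleftrightarrow> 0 < m1 \<and> 0 < m2 \<and> m1 < m \<and> m2 < m"

lemma fst_markoff_step:
  assumes "ordered_triple n"
  shows "fst n < fst (markoff_step s n)" "ordered_triple (markoff_step s n)"
proof -
  obtain m m1 m2 where n: "n = (m, m1, m2)" by (cases n)
  have ord: "0 < m1" "0 < m2" "m1 < m" "m2 < m" using assms n by auto
  have "3 * m \<le> 3 * m * m1" "3 * m \<le> 3 * m * m2"
    using mult_left_mono[of 1 m1 "3 * m"] mult_left_mono[of 1 m2 "3 * m"] ord by auto
  then have "m < 3 * m * m1 - m2" "m < 3 * m * m2 - m1" using ord by linarith+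
  then show "fst n < fst (markoff_step s n)" "ordered_triple (markoff_step s n)"
    using n ord by (cases s, auto)+
qed

lemma markoff_step_inject:
  assumes "ordered_triple n" "ordered_triple n'" "markoff_step s n = markoff_step s' n'"
  shows "s = s' \<and> n = n'"
  using assms by (cases n; cases n'; cases s; cases s') auto

lemma ordered_Sigma_star: "n \<in> Sigma_star \<Longrightarrow> ordered_triple n"
  by (induction rule: Sigma_star.induct) (auto simp: successor_def fst_markoff_step)

lemma fst_Sigma_star: "n \<in> Sigma_star \<Longrightarrow> 2 \<le> fst n"
proof (induction rule: Sigma_star.induct)
  case (succ n s n')
  then show ?case
    using fst_markoff_step(1)[OF ordered_Sigma_star, of n s] by (simp add: successor_def)
qed simp

lemma successor_not_root:
  assumes "n \<in> Sigma_star" "successor s n n'"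
  shows "n' \<noteq> (2, 1, 1)"
  using assms fst_Sigma_star[of n] fst_markoff_step(1)[OF ordered_Sigma_star, of n s]
  by (auto simp: successor_def)

lemma successor_inject:
  assumes "n \<in> Sigma_star" "n' \<in> Sigma_star" "successor s n k" "successor s' n' k"
  shows "s = s' \<and> n = n'"
  using assms markoff_step_inject[OF ordered_Sigma_star ordered_Sigma_star, of n n' s s']
  by (auto simp: successor_def)

lemma markoff_at_Sigma_star: "markoff_at p \<in> Sigma_star \<and> markoff_at p \<noteq> (2, 1, 1)"
proof (induction p rule: rev_induct)
  case Nil
  have "successor Left (2, 1, 1) (markoff_at [])"
    by (simp add: successor_def markoff_at_def)
  then show ?case
    using Sigma_star.succ[OF Sigma_star.root] successor_not_root[OF Sigma_star.root] by blast
next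
  case (snoc s p)
  then have "successor s (markoff_at p) (markoff_at (p @ [s]))"
    by (simp add: successor_def markoff_at_append)
  then show ?case
    using Sigma_star.succ successor_not_root snoc by blast
qed

lemma Sigma_star_cases:
  assumes "n \<in> Sigma_star"
  obtains "n = (2, 1, 1)" | p where "n = markoff_at p"
  using assms
proof (induction arbitrary: thesis rule: Sigma_star.induct)
  case (succ n s n')
  show ?case
  proof (rule succ.IH)
    assume "n = (2, 1, 1)"
    then have "n' = markoff_at []"
      using succ.hyps by (simp add: successor_def markoff_at_def)
    then show thesis by (rule succ.prems(2))
  next
    fix p assume "n = markoff_at p"
    then have "n' = markoff_at (p @ [s])"
      using succ.hyps by (simp add: successor_def markoff_at_append)
    then show thesis by (rule succ.prems(2))
  qed
qed blast

lemma inj_markoff_at: "inj markoff_at"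
proof (rule injI)
  have ord: "ordered_triple (markoff_at p)" for p
    using ordered_Sigma_star markoff_at_Sigma_star by blast
  have lower: "5 \<le> fst (markoff_at p)" for p
  proof (induction p rule: rev_induct)
    case (snoc s p)
    then show ?case
      using fst_markoff_step(1)[OF ord, of p s] by (simp add: markoff_at_append)
  qed (simp add: markoff_at_def)
  have neq: "markoff_at (p @ [s]) \<noteq> markoff_at []" for p s
  proof
    assume "markoff_at (p @ [s]) = markoff_at []"
    then have "fst (markoff_at p) < 5"
      using fst_markoff_step(1)[OF ord, of p s]
      by (simp add: markoff_at_append markoff_at_def[of "[]"])
    then show False using lower[of p] by simp
  qed
  fix p q assume "markoff_at p = markoff_at q"
  then show "p = q"
  proof (induction p arbitrary: q rule: rev_induct)
    case Nil
    then show ?case using neq by (cases q rule: rev_cases) auto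
  next
    case (snoc s p)
    then obtain q' s' where q: "q = q' @ [s']"
      using neq[of p s] by (cases q rule: rev_cases) auto
    then have "s = s' \<and> markoff_at p = markoff_at q'"
      using snoc.prems by (intro markoff_step_inject ord) (simp add: markoff_at_append)
    then show ?case using snoc.IH q by blast
  qed
qed

text \<open>
  The matrix of the word, \<open>x M\<close>, has determinant \<open>1\<close>, trace \<open>3 m\<close> and entries \<open>q = m\<close>, \<open>s = k\<close>; its
  fixed point is therefore \<open>\<alpha>\<^sub>m\<close>.
\<close>

lemma alpha_in_cylinder: "alpha (markoff_at p) \<in> cylinder (node_word p)"
proof -
  obtain m k l m1 k1 l1 m2 k2 l2 where node:
    "markoff_at p = (m, m1, m2)"
    "matrix_at p = (mat22 m k k l, mat22 m1 k1 k1 l1, mat22 m2 k2 k2 l2)"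
    "mat22 m k k l = mat22 m1 k1 k1 l1 ** mat_M ** mat22 m2 k2 k2 l2"
    "m1 * l1 - k1 * k1 = 1" "m2 * l2 - k2 * k2 = 1"
    "cf_mat (path_endo p word_a) = mat22 m1 k1 k1 l1 ** mat_M"
    "cf_mat (path_endo p word_b) = mat22 m2 k2 k2 l2 ** mat_M"
    using node_matrices by blast
  have "cf_mat (node_word p) = mat22 m k k l ** mat_M"
    by (simp add: node_word_def path_endo_append_word word_a_in_W0 cf_mat_append node(3,6,7)
        matrix_mul_assoc)
  then have C: "cf_mat (node_word p) = mat22 (3 * m - k) m (3 * k - l) k"
    by (simp add: mat_M_def mat22_mult mult.commute)
  have "m * l - k * k = 1" using symmetric_product_det node(3-5) .
  then have det: "(3 * m - k) * k - m * (3 * k - l) = 1"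
    by (simp add: algebra_simps)
  have "ordered_triple (markoff_at p)" "markoff_at p \<noteq> (2, 1, 1)"
    using ordered_Sigma_star markoff_at_Sigma_star by auto
  then have m: "0 < m" using node(1) by simp
  have "(THE q. markoff_at q = markoff_at p) = p"
    using inj_markoff_at by (auto dest: injD)
  then have "x_mat (markoff_at p) = mat22 m k k l"
    using node(2) \<open>markoff_at p \<noteq> (2, 1, 1)\<close> by (simp add: x_mat_def)
  then have "alpha (markoff_at p)
      = (k - (3 * m - k) + sqrt (((3 * m - k) + k)\<^sup>2 - 4)) / (2 * m)"
    using node(1) by (simp add: alpha_def Let_def power_mult_distrib)
  also have "\<dots> \<in> cylinder (node_word p)"
    using quadratic_irrational_in_cylinder[OF positive_node_word C det m] by simp
  finally show ?thesis .
qed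

text \<open>The walk from \<open>n\<close> that takes steps on alternating sides, the first one on the side \<open>s\<close>.\<close>

fun alternating :: "side \<Rightarrow> triple \<Rightarrow> nat \<Rightarrow> triple" where
  "alternating s n 0 = n"
| "alternating s n (Suc i) = alternating (other_side s) (markoff_step s n) i"

lemma other_side_eq_iff: "s' = other_side s \<longleftrightarrow> s' \<noteq> s"
  by (cases s; cases s') auto

lemma zigzag_alternating:
  assumes "n \<in> Sigma_star" "n = (2, 1, 1) \<Longrightarrow> s = Left"
  shows "zigzag (alternating s n)"
proof -
  have "alternating s n i \<in> Sigma_star \<and>
    (\<exists>s'. successor s' (alternating s n i) (alternating s n (Suc i)) \<and>
       successor (other_side s') (alternating s n (Suc i)) (alternating s n (Suc (Suc i))))"
    for i
    using assms
  proof (induction i arbitrary: s n)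
    case 0
    then have "successor s n (markoff_step s n)" by (auto simp: successor_def)
    with 0 successor_not_root[of n s] show ?case by (auto simp: successor_def)
  next
    case (Suc i)
    then have "successor s n (markoff_step s n)" by (auto simp: successor_def)
    then have "markoff_step s n \<in> Sigma_star" "markoff_step s n \<noteq> (2, 1, 1)"
      using Suc.prems Sigma_star.succ successor_not_root by blast+
    then show ?case using Suc.IH[of "markoff_step s n" "other_side s"] by auto
  qed
  then show ?thesis by (auto simp: zigzag_def)
qed

lemma zigzag_mem: "zigzag z \<Longrightarrow> z i \<in> Sigma_star"
  by (simp add: zigzag_def)

lemma zigzag_step:
  assumes "zigzag z"
  obtains s where "successor s (z i) (z (Suc i))"
    "successor (other_side s) (z (Suc i)) (z (Suc (Suc i)))"
  using assms unfolding zigzag_def by meson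

lemma zigzag_tail: "zigzag z \<Longrightarrow> zigzag (\<lambda>i. z (Suc i))"
  by (simp add: zigzag_def)

lemma zigzag_sides_alternate:
  assumes "zigzag z" "successor s (z 0) (z 1)"
  shows "successor (other_side s) (z 1) (z 2)"
proof -
  obtain s' where s': "successor s' (z 0) (z (Suc 0))"
      "successor (other_side s') (z (Suc 0)) (z (Suc (Suc 0)))"
    using zigzag_step[OF assms(1)] by blast
  moreover have "successor s' (z 0) (z 1)" using s' by simp
  then have "s = s'"
    using successor_inject[OF zigzag_mem[OF assms(1)] zigzag_mem[OF assms(1)] assms(2)] by blast
  ultimately show ?thesis by (simp add: numeral_2_eq_2)
qed

lemma zigzag_eq_alternating:
  assumes "zigzag z" "successor s (z 0) (z 1)"
  shows "z = alternating s (z 0)"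
proof
  fix i show "z i = alternating s (z 0) i"
    using assms
  proof (induction i arbitrary: z s)
    case (Suc i)
    have "successor (other_side s) (z 1) (z 2)"
      using zigzag_sides_alternate Suc.prems by blast
    then have "z (Suc i) = alternating (other_side s) (z (Suc 0)) i"
      using Suc.IH[OF zigzag_tail, of z "other_side s"] Suc.prems by (simp add: numeral_2_eq_2)
    then show ?case using Suc.prems by (simp add: successor_def)
  qed simp
qed

text \<open>
  A zigzag from a node reached by a step on side \<open>s\<close> is maximal if and only if it starts on the
  side \<open>s\<close> again.
\<close>

lemma zigzag_extend_iff:
  assumes "n \<in> Sigma_star" "zigzag z" "successor s n (z 0)"
  shows "zigzag (case_nat n z) \<longleftrightarrow> \<not> successor s (z 0) (z 1)"
proof
  assume "zigzag (case_nat n z)"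
  then have "successor (other_side s) (z 0) (z 1)"
    using zigzag_sides_alternate[of "case_nat n z" s] assms by (simp add: numeral_2_eq_2)
  then show "\<not> successor s (z 0) (z 1)"
    using successor_inject[OF zigzag_mem zigzag_mem, OF assms(2) assms(2)] other_side_eq_iff
    by blast
next
  assume neg: "\<not> successor s (z 0) (z 1)"
  obtain s' where "successor s' (z 0) (z (Suc 0))" using zigzag_step[OF assms(2)] .
  with neg have "successor (other_side s) (z 0) (z (Suc 0))"
    by (metis One_nat_def other_side_eq_iff)
  then have start: "\<exists>s. successor s n (z 0) \<and> successor (other_side s) (z 0) (z (Suc 0))"
    using assms(3) by blast
  show "zigzag (case_nat n z)"
    unfolding zigzag_def
  proof (intro conjI allI)
    fix i
    show "case_nat n z i \<in> Sigma_star"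
      using assms(1) zigzag_mem[OF assms(2)] by (simp split: nat.split)
    show "\<exists>s. successor s (case_nat n z i) (case_nat n z (Suc i)) \<and>
        successor (other_side s) (case_nat n z (Suc i)) (case_nat n z (Suc (Suc i)))"
      using start zigzag_step[OF assms(2)] by (cases i) (simp, auto)
  qed
qed

lemma zigzag_from_root: "zigzag_from (2, 1, 1) = alternating Left (2, 1, 1)"
  unfolding zigzag_from_def
proof (rule the_equality)
  show "maximal_zigzag (alternating Left (2, 1, 1)) \<and> alternating Left (2, 1, 1) 0 = (2, 1, 1)"
    using zigzag_alternating[OF Sigma_star.root] successor_not_root
    unfolding maximal_zigzag_def by (metis alternating.simps(1))
next
  fix z assume z: "maximal_zigzag z \<and> z 0 = (2, 1, 1)"
  then obtain s where "successor s (z 0) (z 1)"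
    unfolding maximal_zigzag_def by (metis One_nat_def zigzag_step)
  moreover from this z have "s = Left" by (simp add: successor_def)
  ultimately show "z = alternating Left (2, 1, 1)"
    using zigzag_eq_alternating[of z Left] z by (auto simp: maximal_zigzag_def)
qed

lemma zigzag_from_successor:
  assumes "n \<in> Sigma_star" "successor s n n'"
  shows "zigzag_from n' = alternating s n'"
  unfolding zigzag_from_def
proof (rule the_equality)
  have n': "n' \<in> Sigma_star" "n' \<noteq> (2, 1, 1)"
    using assms Sigma_star.succ successor_not_root by blast+
  then have zz: "zigzag (alternating s n')" by (intro zigzag_alternating) auto
  have "successor s n' (alternating s n' 1)" using n' by (simp add: successor_def)
  then show "maximal_zigzag (alternating s n') \<and> alternating s n' 0 = n'"
    using zigzag_extend_iff[OF _ zz] successor_inject[OF assms(1) _ assms(2)] zz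
    unfolding maximal_zigzag_def by (metis alternating.simps(1))
next
  fix z assume z: "maximal_zigzag z \<and> z 0 = n'"
  then have "successor s (z 0) (z 1)"
    using zigzag_extend_iff[OF assms(1), of z s] assms unfolding maximal_zigzag_def by metis
  then show "z = alternating s n'"
    using zigzag_eq_alternating[of z s] z by (auto simp: maximal_zigzag_def)
qed

section \<open>Limits along zigzags\<close>

text \<open>
  The limit of \<open>\<alpha>\<close> along the alternating walk that starts with a right step at position \<open>p\<close>,
  whether or not this walk is a maximal zigzag.
\<close>

definition right_limit :: "side list \<Rightarrow> real" where
  "right_limit p = lim (\<lambda>i. alpha (alternating Right (markoff_at p) i))"

lemma lim_Suc: "lim (\<lambda>i. f (Suc i)) = lim (f :: nat \<Rightarrow> real)"
  by (simp add: lim_def filterlim_sequentially_Suc)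

lemma xi_root: "xi (2, 1, 1) = right_limit []"
proof -
  have "alternating Left (2, 1, 1) (Suc i) = alternating Right (markoff_at []) i" for i
    by (simp add: markoff_at_def)
  then show ?thesis
    using lim_Suc[of "\<lambda>i. alpha (alternating Left (2, 1, 1) i)"]
    by (simp add: xi_def zigzag_from_root right_limit_def del: alternating.simps)
qed

lemma xi_left:
  assumes "zigzag_from (markoff_at p) = alternating Left (markoff_at p)"
  shows "xi (markoff_at p) = right_limit (p @ [Left])"
proof -
  have "alternating Left (markoff_at p) (Suc i)
      = alternating Right (markoff_at (p @ [Left])) i" for i
    by (simp add: markoff_at_append)
  then show ?thesis
    using lim_Suc[of "\<lambda>i. alpha (alternating Left (markoff_at p) i)"]
    by (simp add: xi_def assms right_limit_def del: alternating.simps)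
qed

lemma zigzag_from_markoff_at:
  "zigzag_from (markoff_at []) = alternating Left (markoff_at [])"
  "zigzag_from (markoff_at (p @ [s])) = alternating s (markoff_at (p @ [s]))"
proof -
  have "successor Left (2, 1, 1) (markoff_at [])"
    by (simp add: successor_def markoff_at_def)
  then show "zigzag_from (markoff_at []) = alternating Left (markoff_at [])"
    by (rule zigzag_from_successor[OF Sigma_star.root])
  have "successor s (markoff_at p) (markoff_at (p @ [s]))"
    using markoff_at_Sigma_star by (simp add: successor_def markoff_at_append)
  then show "zigzag_from (markoff_at (p @ [s])) = alternating s (markoff_at (p @ [s]))"
    using markoff_at_Sigma_star by (intro zigzag_from_successor) auto
qed

lemma xi_markoff_at:
  "xi (markoff_at []) = right_limit [Left]"
  "xi (markoff_at (p @ [Left])) = right_limit (p @ [Left, Left])"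
  "xi (markoff_at (p @ [Right])) = right_limit (p @ [Right])"
  using xi_left[of "[]"] xi_left[of "p @ [Left]"]
  by (simp_all add: zigzag_from_markoff_at xi_def right_limit_def)

lemma right_limit_append: "right_limit (p @ [Right, Left]) = right_limit p"
proof -
  have "alternating Right (markoff_at p) (Suc (Suc i))
      = alternating Right (markoff_at (p @ [Right, Left])) i" for i
    using markoff_at_append[of "p @ [Right]" Left] by (simp add: markoff_at_append)
  then show ?thesis
    using lim_Suc[of "\<lambda>i. alpha (alternating Right (markoff_at p) i)"]
      lim_Suc[of "\<lambda>i. alpha (alternating Right (markoff_at p) (Suc i))"]
    by (simp add: right_limit_def del: alternating.simps)
qed

lemma xi_values_eq: "{xi m | m. m \<in> Sigma_star} = range right_limit"
proof (intro set_eqI iffI)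
  fix x assume "x \<in> {xi m | m. m \<in> Sigma_star}"
  then obtain m where m: "m \<in> Sigma_star" "x = xi m" by blast
  show "x \<in> range right_limit"
    using m(1)
  proof (cases rule: Sigma_star_cases)
    case 1
    then show ?thesis using m xi_root by auto
  next
    case (2 p)
    then show ?thesis
    proof (cases p rule: rev_cases)
      case (snoc q s)
      then show ?thesis using m 2 xi_markoff_at(2,3)[of q] by (cases s) auto
    qed (use m xi_markoff_at(1) in auto)
  qed
next
  fix x assume "x \<in> range right_limit"
  then obtain p where "x = right_limit p" by blast
  have mem: "xi (markoff_at q) \<in> {xi m | m. m \<in> Sigma_star}" for q
    using markoff_at_Sigma_star by blast
  \<comment> \<open>Only a path ending in a right and a left step fails to come from a maximal zigzag;
    it is shortened by these two steps.\<close>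
  from \<open>x = right_limit p\<close> show "x \<in> {xi m | m. m \<in> Sigma_star}"
  proof (induction "length p" arbitrary: p rule: less_induct)
    case less
    consider "p = []" | "p = [Left]" | q where "p = q @ [Right]"
      | q where "p = q @ [Left, Left]" | q where "p = q @ [Right, Left]"
    proof (cases p rule: rev_cases)
      case Nil
      then show ?thesis using that by blast
    next
      case (snoc q s)
      then show ?thesis
        using that by (cases q rule: rev_cases; cases s; cases "last q") auto
    qed
    then show ?case
    proof cases
      case 1
      then show ?thesis using less.prems xi_root[symmetric] Sigma_star.root by blast
    next
      case 2
      then show ?thesis using mem[of "[]"] by (simp only: less.prems xi_markoff_at)
    next
      case (3 q)
      then show ?thesis using mem[of p] by (simp only: less.prems xi_markoff_at)
    next
      case (4 q)
      then show ?thesis using mem[of "q @ [Left]"] by (simp only: less.prems xi_markoff_at)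
    next
      case (5 q)
      then show ?thesis using less right_limit_append[of q] by auto
    qed
  qed
qed

text \<open>The position reached from \<open>p\<close> after \<open>i\<close> pairs of a right and a left step.\<close>

fun zigzag_path :: "side list \<Rightarrow> nat \<Rightarrow> side list" where
  "zigzag_path p 0 = p"
| "zigzag_path p (Suc i) = zigzag_path p i @ [Right, Left]"

lemma alternating_even_odd:
  "alternating Right (markoff_at p) (2 * i) = markoff_at (zigzag_path p i)"
  "alternating Right (markoff_at p) (Suc (2 * i)) = markoff_at (zigzag_path p i @ [Right])"
proof -
  have step: "alternating s n (i + j) = alternating ((other_side ^^ i) s) (alternating s n i) j"
    for s n i j
    by (induction i arbitrary: s n) (simp_all add: funpow_swap1)
  have sides: "(other_side ^^ (2 * i)) Right = Right" for i
    by (induction i) auto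
  show even: "alternating Right (markoff_at p) (2 * i) = markoff_at (zigzag_path p i)"
  proof (induction i)
    case (Suc i)
    have "alternating Right (markoff_at p) (2 * i + 2)
        = alternating Right (markoff_at (zigzag_path p i)) 2"
      by (simp only: step sides Suc)
    then show ?case
      using markoff_at_append[of "zigzag_path p i @ [Right]" Left]
      by (simp add: numeral_2_eq_2 markoff_at_append)
  qed simp
  have "alternating Right (markoff_at p) (2 * i + 1)
      = alternating Right (markoff_at (zigzag_path p i)) 1"
    by (simp only: step sides even)
  then show "alternating Right (markoff_at p) (Suc (2 * i))
      = markoff_at (zigzag_path p i @ [Right])"
    by (simp add: markoff_at_append)
qed

lemma node_word_zigzag_path:
  "node_word (zigzag_path p i)
    = path_endo p (((endo_U \<circ> endo_V) ^^ i) (word_a @ word_b))"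
proof -
  have "path_endo (zigzag_path p i) = path_endo p \<circ> ((endo_U \<circ> endo_V) ^^ i)"
  proof (induction i)
    case (Suc i)
    then show ?case
      by (simp add: path_endo_append funpow_Suc_right comp_assoc del: funpow.simps)
  qed simp
  then show ?thesis by (simp add: node_word_def)
qed

lemma cylinder_zigzag_path_mono:
  "i \<le> j \<Longrightarrow> cylinder (node_word (zigzag_path p j)) \<subseteq> cylinder (node_word (zigzag_path p i))"
proof (induction j rule: dec_induct)
  case (step j)
  then show ?case
    using cylinder_append[OF positive_node_word] by (simp add: node_word_Right_Left) blast
qed simp

lemma length_node_word_zigzag_path: "i \<le> length (node_word (zigzag_path p i))"
proof (induction i)
  case (Suc i)
  have "4 \<le> length (node_word (zigzag_path p i @ [Right]))"
    unfolding node_word_def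
    using length_path_endo[OF W0_ab, of "zigzag_path p i @ [Right]"]
    by (simp add: word_a_def word_b_def)
  then show ?case using Suc by (simp add: node_word_Right_Left)
qed simp

lemma alpha_alternating_in_cylinder:
  assumes "2 * i \<le> j"
  shows "alpha (alternating Right (markoff_at p) j) \<in> cylinder (node_word (zigzag_path p i))"
proof -
  define k where "k = j div 2"
  have k: "i \<le> k" "j = 2 * k \<or> j = Suc (2 * k)" using assms by (auto simp: k_def)
  have "positive_word (path_endo q word_b)" for q
    by (intro W0_positive path_endo_W0 word_b_in_W0)
  then have "cylinder (node_word (zigzag_path p k @ [Right]))
      \<subseteq> cylinder (node_word (zigzag_path p k))"
    unfolding node_word_Right by (rule cylinder_append)
  then have "alpha (alternating Right (markoff_at p) j) \<in> cylinder (node_word (zigzag_path p k))"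
    using k(2) alpha_in_cylinder by (auto simp only: alternating_even_odd)
  then show ?thesis using cylinder_zigzag_path_mono[OF k(1)] by blast
qed

theorem theorem6p9:
  fixes \<xi> :: real
  assumes "\<xi> \<notin> \<rat>" and "0 < \<xi>" and "\<xi> < 1"
  shows "\<xi> \<in> {xi m | m. m \<in> Sigma_star} \<longleftrightarrow>
    (\<exists>\<psi> \<in> UV_products. \<forall>i.
       is_prefix (\<psi> (((endo_U \<circ> endo_V) ^^ i) (word_a @ word_b)))
                 (\<lambda>j. partial_quotient \<xi> (Suc j)))"
proof -
  have "\<xi> = right_limit p \<longleftrightarrow>
      (\<forall>i. is_prefix (path_endo p (((endo_U \<circ> endo_V) ^^ i) (word_a @ word_b)))
                     (\<lambda>j. partial_quotient \<xi> (Suc j)))" for p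
  proof -
    have "\<xi> = right_limit p \<longleftrightarrow> (\<forall>i. \<xi> \<in> cylinder (node_word (zigzag_path p i)))"
      unfolding right_limit_def
      by (intro nested_cylinders_limit positive_node_word length_node_word_zigzag_path
          alpha_alternating_in_cylinder)
    then show ?thesis
      by (simp only: is_prefix_iff_cylinder[OF positive_node_word assms]
          flip: node_word_zigzag_path)
  qed
  then show ?thesis
    by (simp only: xi_values_eq UV_products_eq image_iff bex_UNIV bex_simps)
qed

end
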